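(* There exist a vector space $V$ over the two-element field $F_2$ and a subset $S\subseteq V$ such that for every $3$-dimensional affine subspace $W$ of $V$ the intersection $W\cap S$ is the solution set (in $W$) of some quadratic equation, but there is no quadratic equation whose solution set in $V$ is $S$.
   Context: $F_2$ is the field with two elements. A quadratic equation on a vector space $V$ over $F_2$ is an equation $p(x)=0$, where $p:V\to F_2$ is a polynomial of degree at most $2$ in (finitely many) linear functionals on $V$; on an affine subspace $W$ of $V$, a quadratic equation is likewise a polynomial equation of degree at most $2$ in affine coordinates on $W$. Its solution set is the set of points at which $p$ vanishes. The vector space $V$ is not assumed to be finite-dimensional. *)

theory Defs
  imports "HOL-Algebra.Module" "HOL-Number_Theory.Residues"
begin

text \<open>A vector space over a field \<open>K\<close> is a HOL-Algebra \<^locale>\<open>Module.module\<close> over \<open>K\<close>.\<close>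

definition F2 :: "int ring" where
  "F2 = residue_ring 2"

lemma field_F2: "Ring.field F2"
  using residues_prime.is_field[of 2] by (simp add: F2_def residues_prime_def)

definition linear_functional ::
    "('k, 'm) ring_scheme \<Rightarrow> ('k, 'v, 'n) module_scheme \<Rightarrow> ('v \<Rightarrow> 'k) \<Rightarrow> bool" where
  "linear_functional K V f \<longleftrightarrow>
     f \<in> carrier V \<rightarrow> carrier K \<and>
     (\<forall>x\<in>carrier V. \<forall>y\<in>carrier V. f (x \<oplus>\<^bsub>V\<^esub> y) = f x \<oplus>\<^bsub>K\<^esub> f y) \<and>
     (\<forall>a\<in>carrier K. \<forall>x\<in>carrier V. f (a \<odot>\<^bsub>V\<^esub> x) = a \<otimes>\<^bsub>K\<^esub> f x)"

text \<open>
  Polynomial functions of degree at most \<open>2\<close> in \<open>n\<close> variables \<open>t 0, \<dots>, t (n - 1)\<close> over \<open>K\<close>.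
\<close>

definition polynomial_deg2 ::
    "('k, 'm) ring_scheme \<Rightarrow> nat \<Rightarrow> ((nat \<Rightarrow> 'k) \<Rightarrow> 'k) \<Rightarrow> bool" where
  "polynomial_deg2 K n q \<longleftrightarrow>
     (\<exists>c b a. c \<in> carrier K \<and> (\<forall>i<n. b i \<in> carrier K) \<and>
        (\<forall>i<n. \<forall>j<n. a i j \<in> carrier K) \<and>
        (\<forall>t\<in>{..<n} \<rightarrow> carrier K.
           q t = c \<oplus>\<^bsub>K\<^esub> (\<Oplus>\<^bsub>K\<^esub>i\<in>{..<n}. b i \<otimes>\<^bsub>K\<^esub> t i)
                   \<oplus>\<^bsub>K\<^esub> (\<Oplus>\<^bsub>K\<^esub>i\<in>{..<n}. \<Oplus>\<^bsub>K\<^esub>j\<in>{..<n}. a i j \<otimes>\<^bsub>K\<^esub> (t i \<otimes>\<^bsub>K\<^esub> t j))))"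

text \<open>
  The functions \<open>p\<close> below are total on the underlying type; only their values on the
  vector space, respectively on the affine subspace, are constrained.
\<close>

definition quadratic_on_space ::
    "('k, 'm) ring_scheme \<Rightarrow> ('k, 'v, 'n) module_scheme \<Rightarrow> ('v \<Rightarrow> 'k) \<Rightarrow> bool" where
  "quadratic_on_space K V p \<longleftrightarrow>
     (\<exists>n f q. (\<forall>i<n. linear_functional K V (f i)) \<and> polynomial_deg2 K n q \<and>
        (\<forall>x\<in>carrier V. p x = q (\<lambda>i. f i x)))"

definition lin_comb ::
    "('k, 'v, 'n) module_scheme \<Rightarrow> nat \<Rightarrow> (nat \<Rightarrow> 'v) \<Rightarrow> (nat \<Rightarrow> 'k) \<Rightarrow> 'v" where
  "lin_comb V d v \<xi> = (\<Oplus>\<^bsub>V\<^esub>i\<in>{..<d}. \<xi> i \<odot>\<^bsub>V\<^esub> v i)"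

definition lin_indep ::
    "('k, 'm) ring_scheme \<Rightarrow> ('k, 'v, 'n) module_scheme \<Rightarrow> nat \<Rightarrow> (nat \<Rightarrow> 'v) \<Rightarrow> bool" where
  "lin_indep K V d v \<longleftrightarrow>
     (\<forall>i<d. v i \<in> carrier V) \<and>
     (\<forall>\<xi>\<in>{..<d} \<rightarrow> carrier K. lin_comb V d v \<xi> = \<zero>\<^bsub>V\<^esub> \<longrightarrow> (\<forall>i<d. \<xi> i = \<zero>\<^bsub>K\<^esub>))"

text \<open>
  \<open>W\<close> is the translate by \<open>w\<close> of the subspace with basis \<open>v 0, \<dots>, v (d - 1)\<close>. The point
  \<open>w \<oplus>\<^bsub>V\<^esub> lin_comb V d v \<xi>\<close> then has affine coordinates \<open>\<xi> 0, \<dots>, \<xi> (d - 1)\<close>.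
\<close>

definition affine_frame ::
    "('k, 'm) ring_scheme \<Rightarrow> ('k, 'v, 'n) module_scheme \<Rightarrow> nat \<Rightarrow> 'v \<Rightarrow> (nat \<Rightarrow> 'v) \<Rightarrow> 'v set \<Rightarrow> bool"
    where
  "affine_frame K V d w v W \<longleftrightarrow>
     w \<in> carrier V \<and> lin_indep K V d v \<and>
     W = {w \<oplus>\<^bsub>V\<^esub> lin_comb V d v \<xi> |\<xi>. \<xi> \<in> {..<d} \<rightarrow> carrier K}"

definition affine_subspace ::
    "('k, 'm) ring_scheme \<Rightarrow> ('k, 'v, 'n) module_scheme \<Rightarrow> nat \<Rightarrow> 'v set \<Rightarrow> bool" where
  "affine_subspace K V d W \<longleftrightarrow> (\<exists>w v. affine_frame K V d w v W)"

text \<open>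
  For finite-dimensional \<open>W\<close>. The choice of affine coordinates is immaterial, since a change
  of coordinates is an affine substitution and preserves degree at most \<open>2\<close>.
\<close>

definition quadratic_on_affine ::
    "('k, 'm) ring_scheme \<Rightarrow> ('k, 'v, 'n) module_scheme \<Rightarrow> 'v set \<Rightarrow> ('v \<Rightarrow> 'k) \<Rightarrow> bool" where
  "quadratic_on_affine K V W p \<longleftrightarrow>
     (\<exists>d w v q. affine_frame K V d w v W \<and> polynomial_deg2 K d q \<and>
        (\<forall>\<xi>\<in>{..<d} \<rightarrow> carrier K. p (w \<oplus>\<^bsub>V\<^esub> lin_comb V d v \<xi>) = q \<xi>))"

definition solution_set :: "('k, 'm) ring_scheme \<Rightarrow> 'v set \<Rightarrow> ('v \<Rightarrow> 'k) \<Rightarrow> 'v set" where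
  "solution_set K D p = {x \<in> D. p x = \<zero>\<^bsub>K\<^esub>}"

end

theory Submission
  imports Defs
begin

text \<open>
  On the finitely supported sequences over the two-element field, the formula
  \<open>Q x = (\<Sum>i. x i * x (i + 1))\<close> defines a quadratic form that involves infinitely many
  coordinates. On a finite-dimensional affine subspace only finitely many coordinates are
  non-zero, so \<open>Q\<close> restricts to a polynomial of degree at most \<open>2\<close>. A polynomial in \<open>n\<close> linear
  functionals takes the same value at \<open>x + u\<close> and \<open>x + v\<close> for all \<open>x\<close> as soon as the functionals
  agree on \<open>u\<close> and \<open>v\<close>, which by pigeonhole happens for some \<open>u \<noteq> v\<close>; but if \<open>m\<close> is the last index
  at which \<open>u\<close> and \<open>v\<close> differ, then translation by the unit vector \<open>e\<close> at \<open>m + 1\<close> separates them,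
  because \<open>Q (e + u) - Q u = u m + u (m + 2)\<close>.
\<close>

section \<open>The two-element field\<close>

lemma carrier_F2: "carrier F2 = {0, 1}"
  by (auto simp: F2_def residue_ring_def)

lemma add_F2: "x \<oplus>\<^bsub>F2\<^esub> y = (x + y) mod 2"
  by (simp add: F2_def residue_ring_def)

lemma mult_F2: "x \<otimes>\<^bsub>F2\<^esub> y = (x * y) mod 2"
  by (simp add: F2_def residue_ring_def)

lemma zero_F2: "\<zero>\<^bsub>F2\<^esub> = 0"
  by (simp add: F2_def residue_ring_def)

lemma one_F2: "\<one>\<^bsub>F2\<^esub> = 1"
  by (simp add: F2_def residue_ring_def)

lemmas F2_simps = carrier_F2 add_F2 mult_F2 zero_F2 one_F2

lemma cring_F2: "cring F2"
  using field_F2 by (simp add: Ring.field_def domain_def)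

lemma mod_2_in_F2: "(a :: int) mod 2 \<in> carrier F2"
  by (auto simp: carrier_F2)

lemma finsum_F2:
  assumes "finite A"
  shows "(\<Oplus>\<^bsub>F2\<^esub>i\<in>A. g i mod 2) = (\<Sum>i\<in>A. g i) mod 2"
proof -
  interpret cring F2 by (rule cring_F2)
  show ?thesis using assms
    by (induction rule: finite_induct) (simp_all add: mod_2_in_F2 zero_F2 add_F2 mod_simps)
qed

text \<open>The coefficients may be arbitrary integers, to be read modulo \<open>2\<close>.\<close>

lemma polynomial_deg2_F2I:
  fixes c :: int and b :: "nat \<Rightarrow> int" and a :: "nat \<Rightarrow> nat \<Rightarrow> int"
  assumes "\<And>t. t \<in> {..<n} \<rightarrow> carrier F2 \<Longrightarrow>
    q t = (c + (\<Sum>i<n. b i * t i) + (\<Sum>i<n. \<Sum>j<n. a i j * (t i * t j))) mod 2"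
  shows "polynomial_deg2 F2 n q"
  unfolding polynomial_deg2_def
proof (intro exI conjI allI impI ballI)
  show "c mod 2 \<in> carrier F2" "b i mod 2 \<in> carrier F2" "a i j mod 2 \<in> carrier F2" for i j
    by (rule mod_2_in_F2)+
  fix t :: "nat \<Rightarrow> int" assume t: "t \<in> {..<n} \<rightarrow> carrier F2"
  show "q t = c mod 2 \<oplus>\<^bsub>F2\<^esub> (\<Oplus>\<^bsub>F2\<^esub>i\<in>{..<n}. b i mod 2 \<otimes>\<^bsub>F2\<^esub> t i)
      \<oplus>\<^bsub>F2\<^esub> (\<Oplus>\<^bsub>F2\<^esub>i\<in>{..<n}. \<Oplus>\<^bsub>F2\<^esub>j\<in>{..<n}. a i j mod 2 \<otimes>\<^bsub>F2\<^esub> (t i \<otimes>\<^bsub>F2\<^esub> t j))"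
    by (simp add: assms[OF t] add_F2 mult_F2 finsum_F2 mod_simps)
qed

text \<open>\<open>polynomial_deg2\<close> constrains \<open>q\<close> only through a formula in the
  first \<open>n\<close> entries of its argument. The two formulas are compared term by term, since
  \<open>s\<close> and \<open>t\<close> may differ from index \<open>n\<close> on.\<close>

lemma polynomial_deg2_cong:
  assumes "cring K" "polynomial_deg2 K n q" "s \<in> {..<n} \<rightarrow> carrier K"
    and eq: "\<And>i. i < n \<Longrightarrow> s i = t i"
  shows "q s = q t"
proof -
  interpret cring K by fact
  obtain c b a where
    a: "\<forall>i<n. \<forall>j<n. a i j \<in> carrier K" and b: "\<forall>i<n. b i \<in> carrier K" and
    q: "\<And>t. t \<in> {..<n} \<rightarrow> carrier K \<Longrightarrow>
      q t = c \<oplus>\<^bsub>K\<^esub> (\<Oplus>\<^bsub>K\<^esub>i\<in>{..<n}. b i \<otimes>\<^bsub>K\<^esub> t i)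
        \<oplus>\<^bsub>K\<^esub> (\<Oplus>\<^bsub>K\<^esub>i\<in>{..<n}. \<Oplus>\<^bsub>K\<^esub>j\<in>{..<n}. a i j \<otimes>\<^bsub>K\<^esub> (t i \<otimes>\<^bsub>K\<^esub> t j))"
    using assms(2) unfolding polynomial_deg2_def by blast
  have s: "\<And>i. i < n \<Longrightarrow> s i \<in> carrier K"
    using assms(3) by auto
  then have t: "\<And>i. i < n \<Longrightarrow> t i \<in> carrier K"
    using eq by metis
  have "(\<Oplus>\<^bsub>K\<^esub>i\<in>{..<n}. b i \<otimes>\<^bsub>K\<^esub> s i) = (\<Oplus>\<^bsub>K\<^esub>i\<in>{..<n}. b i \<otimes>\<^bsub>K\<^esub> t i)"
    using b t eq by (intro add.finprod_cong') auto
  moreover have "(\<Oplus>\<^bsub>K\<^esub>i\<in>{..<n}. \<Oplus>\<^bsub>K\<^esub>j\<in>{..<n}. a i j \<otimes>\<^bsub>K\<^esub> (s i \<otimes>\<^bsub>K\<^esub> s j))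
      = (\<Oplus>\<^bsub>K\<^esub>i\<in>{..<n}. \<Oplus>\<^bsub>K\<^esub>j\<in>{..<n}. a i j \<otimes>\<^bsub>K\<^esub> (t i \<otimes>\<^bsub>K\<^esub> t j))"
    using a t eq by (intro add.finprod_cong') (auto intro!: finsum_closed)
  ultimately show ?thesis
    using q[of s] q[of t] s t by auto
qed

section \<open>Finitely supported sequences\<close>

text \<open>The direct sum of countably many copies of \<open>F2\<close>. The module record extends
  the ring record; vectors have no product, hence the two \<open>undefined\<close> fields.\<close>

definition fin_seq :: "(int, nat \<Rightarrow> int) module" where
  "fin_seq = \<lparr>carrier = {x. (\<forall>i. x i \<in> {0, 1}) \<and> eventually (\<lambda>i. x i = 0) sequentially},
     monoid.mult = undefined, one = undefined, zero = (\<lambda>_. 0), add = (\<lambda>x y i. (x i + y i) mod 2),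
     smult = (\<lambda>a x i. (a * x i) mod 2)\<rparr>"

lemma zero_fin_seq: "\<zero>\<^bsub>fin_seq\<^esub> = (\<lambda>_. 0)"
  by (simp add: fin_seq_def)

lemma add_fin_seq: "x \<oplus>\<^bsub>fin_seq\<^esub> y = (\<lambda>i. (x i + y i) mod 2)"
  by (simp add: fin_seq_def)

lemma smult_fin_seq: "a \<odot>\<^bsub>fin_seq\<^esub> x = (\<lambda>i. (a * x i) mod 2)"
  by (simp add: fin_seq_def)

lemma carrier_fin_seq:
  "x \<in> carrier fin_seq \<longleftrightarrow> (\<forall>i. x i \<in> {0, 1}) \<and> eventually (\<lambda>i. x i = 0) sequentially"
  by (simp add: fin_seq_def)

lemma fin_seq_mod_2: "x \<in> carrier fin_seq \<Longrightarrow> x i mod 2 = x i"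
  unfolding carrier_fin_seq by (metis empty_iff insert_iff mod_0 one_mod_two_eq_one)

lemma mod_2_in_fin_seq:
  "eventually (\<lambda>i. x i = 0) sequentially \<Longrightarrow> (\<lambda>i. x i mod 2) \<in> carrier fin_seq"
  unfolding carrier_fin_seq by (auto elim: eventually_mono)

lemma fin_seq_add_closed:
  assumes "x \<in> carrier fin_seq" "y \<in> carrier fin_seq"
  shows "x \<oplus>\<^bsub>fin_seq\<^esub> y \<in> carrier fin_seq"
  unfolding add_fin_seq using assms
  by (intro mod_2_in_fin_seq) (auto simp: carrier_fin_seq elim: eventually_elim2)

lemma fin_seq_smult_closed:
  "x \<in> carrier fin_seq \<Longrightarrow> a \<odot>\<^bsub>fin_seq\<^esub> x \<in> carrier fin_seq"
  unfolding smult_fin_seq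
  by (intro mod_2_in_fin_seq) (auto simp: carrier_fin_seq elim: eventually_mono)

lemma zero_in_fin_seq: "(\<lambda>_. 0) \<in> carrier fin_seq"
  by (simp add: carrier_fin_seq)

lemma module_fin_seq: "Module.module F2 fin_seq"
proof (intro module.intro module_axioms.intro abelian_groupI cring_F2)
  fix x assume x: "x \<in> carrier fin_seq"
  then show "\<exists>y\<in>carrier fin_seq. y \<oplus>\<^bsub>fin_seq\<^esub> x = \<zero>\<^bsub>fin_seq\<^esub>"
    \<comment> \<open>In characteristic 2 every vector is its own negative.\<close>
    by (intro bexI[of _ x]) (auto simp: add_fin_seq zero_fin_seq)
qed (auto simp: fin_seq_add_closed[unfolded add_fin_seq] fin_seq_smult_closed[unfolded smult_fin_seq]
      zero_in_fin_seq fin_seq_mod_2 F2_simps add_fin_seq zero_fin_seq smult_fin_seq mod_simps algebra_simps)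

lemma lin_comb_fin_seq:
  assumes "\<And>j. j < d \<Longrightarrow> v j \<in> carrier fin_seq"
  shows "lin_comb fin_seq d v \<xi> = (\<lambda>i. (\<Sum>j<d. \<xi> j * v j i) mod 2)"
proof -
  interpret Module.module F2 fin_seq by (rule module_fin_seq)
  show ?thesis using assms
  proof (induction d)
    case 0
    then show ?case by (simp add: lin_comb_def zero_fin_seq)
  next
    case (Suc d)
    have "lin_comb fin_seq (Suc d) v \<xi>
      = \<xi> d \<odot>\<^bsub>fin_seq\<^esub> v d \<oplus>\<^bsub>fin_seq\<^esub> lin_comb fin_seq d v \<xi>"
      using Suc.prems by (simp add: lin_comb_def lessThan_Suc Pi_def fin_seq_smult_closed)
    with Suc show ?case
      by (simp add: add_fin_seq smult_fin_seq mod_simps algebra_simps)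
  qed
qed

definition unit_seq :: "nat \<Rightarrow> nat \<Rightarrow> int" where
  "unit_seq k = (\<lambda>i. of_bool (i = k))"

lemma unit_seq_in_fin_seq: "unit_seq k \<in> carrier fin_seq"
  unfolding carrier_fin_seq unit_seq_def
  by (auto intro!: eventually_mono[OF eventually_gt_at_top[of k]])

lemma infinite_fin_seq: "infinite (carrier fin_seq)"
proof -
  have "inj unit_seq"
    by (auto simp: inj_def unit_seq_def fun_eq_iff)
  then show ?thesis
    using unit_seq_in_fin_seq by (metis finite_subset image_subsetI range_inj_infinite)
qed

section \<open>The quadratic form\<close>

text \<open>Summing over the support gives a finite sum on \<open>fin_seq\<close> without a choice
  of bound.\<close>

definition shift_form :: "(nat \<Rightarrow> int) \<Rightarrow> int" where
  "shift_form x = (\<Sum>i | x i \<noteq> 0. x i * x (Suc i)) mod 2"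

text \<open>Summands outside the support vanish, so any initial segment containing it may serve as
  the range. Several sequences can thus share one range.\<close>

lemma shift_form_eq:
  assumes "\<And>i. i \<ge> N \<Longrightarrow> x i = 0"
  shows "shift_form x = (\<Sum>i<N. x i * x (Suc i)) mod 2"
proof -
  have "{i. x i \<noteq> 0} \<subseteq> {..<N}"
    using assms by (metis (mono_tags) lessThan_iff linorder_not_le mem_Collect_eq subsetI)
  then show ?thesis
    unfolding shift_form_def by (intro arg_cong[where f = "\<lambda>s. s mod 2"] sum.mono_neutral_left) auto
qed

text \<open>Reduction modulo 2 is compatible with sums and products, so the form of a sum of
  sequences can be expanded over the integers and reduced once at the end.\<close>

lemma shift_form_mod:
  assumes "\<And>i. i \<ge> N \<Longrightarrow> x i = 0"
  shows "shift_form (\<lambda>i. x i mod 2) = (\<Sum>i<N. x i * x (Suc i)) mod 2"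
proof -
  have "(\<Sum>i<N. x i mod 2 * (x (Suc i) mod 2)) mod 2 = (\<Sum>i<N. x i * x (Suc i)) mod 2"
    by (subst (1 2) mod_sum_eq[symmetric]) (simp add: mod_simps)
  with assms show ?thesis
    by (subst shift_form_eq[of N]) auto
qed

text \<open>The cross terms of the expansion pair the unit entry at \<open>Suc m\<close> with its
  two neighbours in \<open>u\<close>, and the form vanishes on the unit sequence itself.\<close>

lemma shift_form_unit_seq_add:
  assumes "u \<in> carrier fin_seq"
  shows "shift_form (unit_seq (Suc m) \<oplus>\<^bsub>fin_seq\<^esub> u)
    = (shift_form u + u m + u (Suc (Suc m))) mod 2"
proof -
  obtain M where M: "\<And>i. i \<ge> M \<Longrightarrow> u i = 0"
    using assms unfolding carrier_fin_seq eventually_sequentially by blast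
  \<comment> \<open>The bound exceeds \<open>Suc m\<close>, so both cross terms, at the indices
    \<open>m\<close> and \<open>Suc m\<close>, fall inside the range.\<close>
  define N where "N = max M (Suc (Suc m))"
  define e where "e = unit_seq (Suc m)"
  have N: "\<And>i. i \<ge> N \<Longrightarrow> u i = 0" "\<And>i. i \<ge> N \<Longrightarrow> e i = 0" "m < N" "Suc m < N"
    using M by (auto simp: N_def e_def unit_seq_def)
  have "(\<Sum>i<N. e i * e (Suc i)) = 0"
    by (rule sum.neutral) (simp add: e_def unit_seq_def)
  moreover have "(\<Sum>i<N. u i * e (Suc i)) = u m"
    using N by (simp add: e_def unit_seq_def)
  moreover have "(\<Sum>i<N. e i * u (Suc i)) = u (Suc (Suc m))"
    using N by (simp add: e_def unit_seq_def)
  ultimately have "(\<Sum>i<N. (e i + u i) * (e (Suc i) + u (Suc i)))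
    = (\<Sum>i<N. u i * u (Suc i)) + u m + u (Suc (Suc m))"
    by (simp add: algebra_simps sum.distrib)
  then show ?thesis
    unfolding add_fin_seq e_def[symmetric] using N
    by (subst shift_form_mod[of N]) (simp_all add: shift_form_eq[of N u], presburger)
qed

section \<open>Restriction to finite-dimensional affine subspaces\<close>

lemma quadratic_on_affine_shift_form:
  assumes "affine_frame F2 fin_seq d w v W"
  shows "quadratic_on_affine F2 fin_seq W shift_form"
  unfolding quadratic_on_affine_def
proof (intro exI conjI ballI)
  show "affine_frame F2 fin_seq d w v W" by fact
  \<comment> \<open>The polynomial is the form itself, read in the coordinates of the given frame;
    what remains is its degree.\<close>
  let ?q = "\<lambda>\<xi>. shift_form (w \<oplus>\<^bsub>fin_seq\<^esub> lin_comb fin_seq d v \<xi>)"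
  have w: "w \<in> carrier fin_seq" and v: "\<And>j. j < d \<Longrightarrow> v j \<in> carrier fin_seq"
    using assms by (auto simp: affine_frame_def lin_indep_def)
  have "eventually (\<lambda>i. w i = 0 \<and> (\<forall>j\<in>{..<d}. v j i = 0)) sequentially"
    using w v by (auto simp: carrier_fin_seq intro!: eventually_conj eventually_ball_finite)
  then obtain N where N: "\<And>i. i \<ge> N \<Longrightarrow> w i = 0" "\<And>i j. i \<ge> N \<Longrightarrow> j < d \<Longrightarrow> v j i = 0"
    unfolding eventually_sequentially by auto
  show "polynomial_deg2 F2 d ?q"
  proof (rule polynomial_deg2_F2I)
    fix t :: "nat \<Rightarrow> int"
    \<comment> \<open>Entry \<open>i\<close> of the linear combination before reduction modulo 2, an
      integer linear form in \<open>t\<close>.\<close>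
    define L where "L i = (\<Sum>j<d. t j * v j i)" for i
    have "?q t = shift_form (\<lambda>i. (w i + L i) mod 2)"
      by (simp add: lin_comb_fin_seq v add_fin_seq L_def mod_simps)
    also have "\<dots> = (\<Sum>i<N. (w i + L i) * (w (Suc i) + L (Suc i))) mod 2"
      using N by (intro shift_form_mod) (simp add: L_def)
    \<comment> \<open>The three sums are homogeneous of degree 0, 1 and 2 in \<open>t\<close>;
      interchanging summations then exposes their coefficients.\<close>
    also have "(\<Sum>i<N. (w i + L i) * (w (Suc i) + L (Suc i)))
      = (\<Sum>i<N. w i * w (Suc i)) + (\<Sum>i<N. w i * L (Suc i) + L i * w (Suc i))
        + (\<Sum>i<N. L i * L (Suc i))"
      by (simp add: algebra_simps sum.distrib)
    also have "(\<Sum>i<N. w i * L (Suc i) + L i * w (Suc i))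
      = (\<Sum>j<d. (\<Sum>i<N. w i * v j (Suc i) + v j i * w (Suc i)) * t j)"
      unfolding L_def sum_distrib_left sum_distrib_right sum.distrib[symmetric]
      by (subst sum.swap) (simp add: algebra_simps)
    also have "(\<Sum>i<N. L i * L (Suc i))
      = (\<Sum>j<d. \<Sum>k<d. (\<Sum>i<N. v j i * v k (Suc i)) * (t j * t k))"
    proof -
      have "(\<Sum>i<N. L i * L (Suc i))
        = (\<Sum>i<N. \<Sum>j<d. \<Sum>k<d. v j i * v k (Suc i) * (t j * t k))"
        unfolding L_def sum_product by (simp add: algebra_simps)
      also have "\<dots> = (\<Sum>j<d. \<Sum>i<N. \<Sum>k<d. v j i * v k (Suc i) * (t j * t k))"
        by (rule sum.swap)
      also have "\<dots> = (\<Sum>j<d. \<Sum>k<d. \<Sum>i<N. v j i * v k (Suc i) * (t j * t k))"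
        by (intro sum.cong refl sum.swap)
      finally show ?thesis by (simp add: sum_distrib_right)
    qed
    finally show "?q t = ((\<Sum>i<N. w i * w (Suc i))
      + (\<Sum>j<d. (\<Sum>i<N. w i * v j (Suc i) + v j i * w (Suc i)) * t j)
      + (\<Sum>j<d. \<Sum>k<d. (\<Sum>i<N. v j i * v k (Suc i)) * (t j * t k))) mod 2" .
  qed
qed simp

section \<open>Polynomials in finitely many functionals on an infinite space\<close>

lemma quadratic_on_space_translation:
  assumes "Module.module K V" "finite (carrier K)" "infinite (carrier V)"
    and "quadratic_on_space K V p"
  obtains u v where "u \<in> carrier V" "v \<in> carrier V" "u \<noteq> v"
    "\<And>x. x \<in> carrier V \<Longrightarrow> p (x \<oplus>\<^bsub>V\<^esub> u) = p (x \<oplus>\<^bsub>V\<^esub> v)"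
proof -
  interpret Module.module K V by fact
  obtain n f q where f: "\<And>i. i < n \<Longrightarrow> linear_functional K V (f i)"
    and q: "polynomial_deg2 K n q" and p: "\<And>x. x \<in> carrier V \<Longrightarrow> p x = q (\<lambda>i. f i x)"
    using assms(4) unfolding quadratic_on_space_def by blast
  \<comment> \<open>For \<open>i \<ge> n\<close> nothing is known about \<open>f i\<close>; the
    restriction places all value vectors in one finite set of functions, as the pigeonhole argument
    requires.\<close>
  let ?F = "\<lambda>x. restrict (\<lambda>i. f i x) {..<n}"
  have closed: "f i x \<in> carrier K" if "i < n" "x \<in> carrier V" for i x
    using f that unfolding linear_functional_def by blast
  have "?F ` carrier V \<subseteq> {..<n} \<rightarrow>\<^sub>E carrier K"
    using closed by (simp add: image_subset_iff restrict_PiE_iff)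
  then have "finite (?F ` carrier V)"
    using assms(2) by (meson finite_PiE finite_lessThan finite_subset)
  then have "\<not> inj_on ?F (carrier V)"
    using assms(3) finite_imageD by blast
  then obtain u v where uv: "u \<in> carrier V" "v \<in> carrier V" "u \<noteq> v" and "?F u = ?F v"
    unfolding inj_on_def by blast
  then have eq: "f i u = f i v" if "i < n" for i
    using that by (metis lessThan_iff restrict_apply')
  have "p (x \<oplus>\<^bsub>V\<^esub> u) = p (x \<oplus>\<^bsub>V\<^esub> v)" if x: "x \<in> carrier V" for x
  proof -
    have "f i (x \<oplus>\<^bsub>V\<^esub> u) = f i (x \<oplus>\<^bsub>V\<^esub> v)" if "i < n" for i
      using f[OF that] eq[OF that] x uv unfolding linear_functional_def by simp
    then have "q (\<lambda>i. f i (x \<oplus>\<^bsub>V\<^esub> u)) = q (\<lambda>i. f i (x \<oplus>\<^bsub>V\<^esub> v))"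
      using q x uv closed by (intro polynomial_deg2_cong[OF is_cring q]) auto
    with p x uv show ?thesis by simp
  qed
  with uv show ?thesis by (rule that)
qed

lemma not_quadratic_on_space_shift_form: "\<not> quadratic_on_space F2 fin_seq shift_form"
proof
  assume "quadratic_on_space F2 fin_seq shift_form"
  then obtain u v where u: "u \<in> carrier fin_seq" and v: "v \<in> carrier fin_seq" and "u \<noteq> v"
    and eq: "\<And>x. x \<in> carrier fin_seq \<Longrightarrow>
      shift_form (x \<oplus>\<^bsub>fin_seq\<^esub> u) = shift_form (x \<oplus>\<^bsub>fin_seq\<^esub> v)"
    using quadratic_on_space_translation[OF module_fin_seq _ infinite_fin_seq]
    by (metis carrier_F2 finite.emptyI finite.insertI)
  \<comment> \<open>Translation by zero compares the form at \<open>u\<close> and \<open>v\<close>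
    themselves.\<close>
  have Q: "shift_form u = shift_form v"
    using eq[OF zero_in_fin_seq] u v by (simp add: add_fin_seq fin_seq_mod_2)
  have "eventually (\<lambda>i. u i = v i) sequentially"
    using u v by (auto simp: carrier_fin_seq elim: eventually_elim2)
  then obtain N where N: "\<And>i. i \<ge> N \<Longrightarrow> u i = v i"
    unfolding eventually_sequentially by blast
  \<comment> \<open>At the last difference, \<open>u\<close> and \<open>v\<close> agree at
    \<open>m + 2\<close>, so the unit sequence at \<open>m + 1\<close> compares only
    \<open>u m\<close> with \<open>v m\<close>.\<close>
  define m where "m = (GREATEST i. u i \<noteq> v i)"
  obtain k where "u k \<noteq> v k"
    using \<open>u \<noteq> v\<close> by auto
  then have "u m \<noteq> v m" and "\<And>i. u i \<noteq> v i \<Longrightarrow> i \<le> m"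
    unfolding m_def using N
    by (metis (mono_tags, lifting) GreatestI_nat nat_le_linear,
        metis (mono_tags, lifting) Greatest_le_nat nat_le_linear)
  then have "u (Suc (Suc m)) = v (Suc (Suc m))"
    by (meson Suc_n_not_le_n le_SucI le_trans lessI less_imp_le_nat)
  moreover have "(shift_form u + u m + u (Suc (Suc m))) mod 2
    = (shift_form v + v m + v (Suc (Suc m))) mod 2"
    using eq[OF unit_seq_in_fin_seq, of "Suc m"] u v by (simp add: shift_form_unit_seq_add)
  ultimately have "u m mod 2 = v m mod 2"
    using Q by presburger
  then show False
    using \<open>u m \<noteq> v m\<close> u v by (simp add: fin_seq_mod_2)
qed

text \<open>The only nonzero element of \<open>F2\<close> is 1, so the zero set determines the
  function. This turns the claim about equations into one about functions.\<close>

lemma solution_set_F2_inject: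
  assumes "p x \<in> carrier F2" "q x \<in> carrier F2"
    and "solution_set F2 D p = solution_set F2 D q" "x \<in> D"
  shows "p x = q x"
proof -
  have "p x = 0 \<longleftrightarrow> q x = 0"
    using assms(3,4) unfolding solution_set_def zero_F2 by blast
  then show ?thesis
    using assms(1,2) unfolding carrier_F2 by auto
qed

text \<open>The polynomial formula stays in the field when evaluated at functionals, so zero sets
  over \<open>F2\<close> can be compared as above.\<close>

lemma quadratic_on_space_closed:
  assumes "Module.module K V" "quadratic_on_space K V p" "x \<in> carrier V"
  shows "p x \<in> carrier K"
proof -
  interpret Module.module K V by fact
  show ?thesis
    using assms(2,3)
    unfolding quadratic_on_space_def polynomial_deg2_def linear_functional_def
    by (auto simp: Pi_def intro!: a_closed finsum_closed m_closed)
qed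

theorem corollary4p2:
  shows "\<exists>(V :: (int, nat \<Rightarrow> int) module) S.
    Module.module F2 V \<and> S \<subseteq> carrier V \<and>
    (\<forall>W. affine_subspace F2 V 3 W \<longrightarrow>
       (\<exists>p. quadratic_on_affine F2 V W p \<and> W \<inter> S = solution_set F2 W p)) \<and>
    \<not> (\<exists>p. quadratic_on_space F2 V p \<and> S = solution_set F2 (carrier V) p)"
proof (intro exI conjI allI impI)
  \<comment> \<open>The same equation, given by \<open>shift_form\<close>, serves every
    \<open>W\<close>.\<close>
  let ?S = "solution_set F2 (carrier fin_seq) shift_form"
  show "Module.module F2 fin_seq"
    by (rule module_fin_seq)
  show "?S \<subseteq> carrier fin_seq"
    by (auto simp: solution_set_def)
  fix W assume "affine_subspace F2 fin_seq 3 W"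
  then obtain w v where frame: "affine_frame F2 fin_seq 3 w v W"
    unfolding affine_subspace_def by blast
  then show "quadratic_on_affine F2 fin_seq W shift_form"
    by (rule quadratic_on_affine_shift_form)
  interpret Module.module F2 fin_seq by (rule module_fin_seq)
  have "W \<subseteq> carrier fin_seq"
    using frame unfolding affine_frame_def lin_indep_def lin_comb_def
    by (auto intro!: M.a_closed M.finsum_closed fin_seq_smult_closed)
  then show "W \<inter> ?S = solution_set F2 W shift_form"
    by (auto simp: solution_set_def)
next
  show "\<not> (\<exists>p. quadratic_on_space F2 fin_seq p \<and>
      solution_set F2 (carrier fin_seq) shift_form = solution_set F2 (carrier fin_seq) p)"
  proof
    assume "\<exists>p. quadratic_on_space F2 fin_seq p \<and>
      solution_set F2 (carrier fin_seq) shift_form = solution_set F2 (carrier fin_seq) p"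
    then obtain p where p: "quadratic_on_space F2 fin_seq p"
      and S: "solution_set F2 (carrier fin_seq) shift_form = solution_set F2 (carrier fin_seq) p"
      by blast
    \<comment> \<open>Equal zero sets force \<open>p\<close> and the form to agree on the whole
      space, so the form would itself be quadratic there.\<close>
    have "shift_form x = p x" if "x \<in> carrier fin_seq" for x
      using quadratic_on_space_closed[OF module_fin_seq p] S that
      by (intro solution_set_F2_inject[of shift_form x p "carrier fin_seq"])
        (simp_all add: shift_form_def mod_2_in_F2)
    then have "quadratic_on_space F2 fin_seq shift_form"
      using p unfolding quadratic_on_space_def by simp
    then show False
      using not_quadratic_on_space_shift_form by contradiction
  qed
qed

end
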